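(* Let $\widetilde a$ be a unitary transition amplitude on $\mathcal P$ with product coupling constants $c_{n,j}^k$. Fix $n\ge1$ and $j\in\{0,1,\ldots,4^{n-1}-1\}$ and assume $c_{n,j}^0\ne0$. Let $[Q_{n+1,j}^0,P_{n+1,j}^0]=Q_{n+1,j}^0P_{n+1,j}^0-P_{n+1,j}^0Q_{n+1,j}^0$, an operator on the four-dimensional space $H_{n+1,j}$, and write vectors of $H_{n+1,j}$ in coordinates with respect to the ordered orthonormal basis $\widehat x_{n+1,4j},\widehat x_{n+1,4j+1},\widehat x_{n+1,4j+2},\widehat x_{n+1,4j+3}$. Then the eigenvalues of $[Q_{n+1,j}^0,P_{n+1,j}^0]$ are $0$ (with multiplicity 2) and $$\lambda_\pm=\pm i\,|c_{n,j}^0|\bigl[1-|c_{n,j}^0|^2\bigr]^{1/2},$$ with corresponding eigenvectors $$v_r=(0,a_r,b_r,c_r),\qquad r=1,2,$$ where $(a_r,b_r,c_r)\perp(\overline{c_{n,j}^1},\overline{c_{n,j}^2},\overline{c_{n,j}^3})$, in the sense that $a_r\overline{c_{n,j}^1}+b_r\overline{c_{n,j}^2}+c_r\overline{c_{n,j}^3}=0$, for $r=1,2$, with $v_1\perp v_2$ (in the Hermitian inner product) and $v_r\ne0$, and $$v_\pm=\bigl(\lambda_\pm,\,-\overline{c_{n,j}^0}\,c_{n,j}^1,\,-\overline{c_{n,j}^0}\,c_{n,j}^2,\,-\overline{c_{n,j}^0}\,c_{n,j}^3\bigr).$$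
   Context: For $n=1,2,\ldots$ let $\mathcal P_n=\{x_{n,0},x_{n,1},\ldots,x_{n,4^{n-1}-1}\}$ be a set of $4^{n-1}$ distinct elements, the $\mathcal P_n$ being pairwise disjoint, and let $\mathcal P=\bigcup_n\mathcal P_n$. (In the source, $\mathcal P_n$ is the set of covariant finite posets of cardinality $2n-1$, suitably ordered; only the tree structure matters here.) Write $x\to y$ if and only if $x=x_{n,j}$ and $y=x_{n+1,4j+k}$ for some $n\ge1$, $0\le j\le 4^{n-1}-1$, $k\in\{0,1,2,3\}$. A unitary transition amplitude is a map $\widetilde a\colon\mathcal P\times\mathcal P\to\mathbb C$ with $\widetilde a(x,y)=0$ if $x\not\to y$, and $\sum_{y}\widetilde a(x,y)=\sum_{y}|\widetilde a(x,y)|^2=1$ for every $x\in\mathcal P$. Its coupling constants are $c_{n,j}^k=\widetilde a(x_{n,j},x_{n+1,4j+k})$, $k=0,1,2,3$. They are product coupling constants if for all $n,j$ there are complex numbers $e^0,e^1,f^0,f^1$ (depending on $n,j$) with $e^0+e^1=|e^0|^2+|e^1|^2=1$, $f^0+f^1=|f^0|^2+|f^1|^2=1$ and $$c_{n,j}^0=e^0f^0,\quad c_{n,j}^1=e^1f^0,\quad c_{n,j}^2=e^0f^1,\quad c_{n,j}^3=e^1f^1 .$$ $H_n$ is the Hilbert space of all functions $f\colon\mathcal P_n\to\mathbb C$ with inner product $\langle f,g\rangle=\sum_{x}\overline{f(x)}g(x)$; $\widehat x_{n,j}$ is the characteristic function of $\{x_{n,j}\}$. $H_{n+1}=\bigoplus_{j=0}^{4^{n-1}-1}H_{n+1,j}$,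 where $H_{n+1,j}$ has orthonormal basis $\{\widehat x_{n+1,4j+k}:k=0,1,2,3\}$. The operator $V_{n+1,j}$ on $H_{n+1,j}$ is the unitary operator whose matrix in the ordered orthonormal basis $\widehat x_{n+1,4j},\widehat x_{n+1,4j+1},\widehat x_{n+1,4j+2},\widehat x_{n+1,4j+3}$ of $H_{n+1,j}$ is the (symmetric) matrix $$C_j=\begin{bmatrix} c^0 & c^1 & c^2 & c^3 \\ c^1 & c^0 & c^3 & c^2 \\ c^2 & c^3 & c^0 & c^1 \\ c^3 & c^2 & c^1 & c^0 \end{bmatrix},\qquad c^k=c_{n,j}^k .$$ Coordinate observables: for $0\le m\le 4^{n}-1$ write $m$ in base 4 with exactly $n$ digits, $m=m_{n-1}\cdots m_1m_0$ (leading zeros included), $m_i\in\{0,1,2,3\}$. For $k\in\{0,1,2,3\}$ let $m^k=\sum_{i=0}^{n-1}m_i'4^i$ where $m_i'=1$ if $m_i=k$ and $m_i'=0$ otherwise. Then $Q_{n+1}^k$ is the operator on $H_{n+1}$ with $Q_{n+1}^k\widehat x_{n+1,m}=m^k\widehat x_{n+1,m}$, and $Q_{n+1,j}^k$ is its restriction to the invariant subspace $H_{n+1,j}$. The conjugate momentum observable on $H_{n+1,j}$ is $P_{n+1,j}^k=V_{n+1,j}Q_{n+1,j}^kV_{n+1,j}^*$.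
   Formalization: When |c^0_{n,j}|=1 the commutator is 0 and v_± = 0, so that v_± are (nonzero) eigenvectors, and that the eigenspace for 0 has dimension 2, is claimed only for |c^0_{n,j}| ≠ 1; the other claims are unrestricted. *)

theory Defs
  imports
    "HOL-Analysis.Infinite_Sum"
    "HOL-Library.Function_Algebras"
    "Jordan_Normal_Form.Char_Poly"
begin

text \<open>\<open>x n j\<close> stands for \<open>x\<^sub>n\<^sub>,\<^sub>j\<close>; only the values with \<open>n \<ge> 1\<close> and \<open>j < 4 ^ (n - 1)\<close> matter.\<close>

definition level :: "(nat \<Rightarrow> nat \<Rightarrow> 'p) \<Rightarrow> nat \<Rightarrow> 'p set" where
  "level x n = x n ` {..<4 ^ (n - 1)}"

definition poset_labelling :: "(nat \<Rightarrow> nat \<Rightarrow> 'p) \<Rightarrow> bool" where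
  "poset_labelling x \<longleftrightarrow>
     (\<forall>n\<ge>1. inj_on (x n) {..<4 ^ (n - 1)}) \<and>
     (\<forall>n\<ge>1. \<forall>m\<ge>1. n \<noteq> m \<longrightarrow> level x n \<inter> level x m = {})"

definition all_posets :: "(nat \<Rightarrow> nat \<Rightarrow> 'p) \<Rightarrow> 'p set" where
  "all_posets x = (\<Union>n\<in>{1..}. level x n)"

definition produces :: "(nat \<Rightarrow> nat \<Rightarrow> 'p) \<Rightarrow> 'p \<Rightarrow> 'p \<Rightarrow> bool" where
  "produces x p q \<longleftrightarrow>
     (\<exists>n\<ge>1. \<exists>j<4 ^ (n - 1). \<exists>k<4. p = x n j \<and> q = x (n + 1) (4 * j + k))"

definition unitary_transition_amplitude ::
  "(nat \<Rightarrow> nat \<Rightarrow> 'p) \<Rightarrow> ('p \<Rightarrow> 'p \<Rightarrow> complex) \<Rightarrow> bool" where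
  "unitary_transition_amplitude x a \<longleftrightarrow>
     (\<forall>p\<in>all_posets x. \<forall>q\<in>all_posets x. \<not> produces x p q \<longrightarrow> a p q = 0) \<and>
     (\<forall>p\<in>all_posets x. (a p has_sum 1) (all_posets x) \<and>
        ((\<lambda>q. (cmod (a p q))\<^sup>2) has_sum 1) (all_posets x))"

definition coupling ::
  "(nat \<Rightarrow> nat \<Rightarrow> 'p) \<Rightarrow> ('p \<Rightarrow> 'p \<Rightarrow> complex) \<Rightarrow> nat \<Rightarrow> nat \<Rightarrow> nat \<Rightarrow> complex" where
  "coupling x a n j k = a (x n j) (x (n + 1) (4 * j + k))"

definition product_coupling ::
  "(nat \<Rightarrow> nat \<Rightarrow> 'p) \<Rightarrow> ('p \<Rightarrow> 'p \<Rightarrow> complex) \<Rightarrow> bool" where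
  "product_coupling x a \<longleftrightarrow>
     (\<forall>n\<ge>1. \<forall>j<4 ^ (n - 1). \<exists>e0 e1 f0 f1 :: complex.
        e0 + e1 = 1 \<and> (cmod e0)\<^sup>2 + (cmod e1)\<^sup>2 = 1 \<and>
        f0 + f1 = 1 \<and> (cmod f0)\<^sup>2 + (cmod f1)\<^sup>2 = 1 \<and>
        coupling x a n j 0 = e0 * f0 \<and> coupling x a n j 1 = e1 * f0 \<and>
        coupling x a n j 2 = e0 * f1 \<and> coupling x a n j 3 = e1 * f1)"

text \<open>A function on \<open>\<P>\<^sub>n\<close> is represented by its extension by \<open>0\<close> to the whole type. The subspace
  \<open>H\<^sub>n\<^sub>+\<^sub>1\<^sub>,\<^sub>j\<close> is \<open>Hsub x n j\<close>: the level index in \<open>Hsub\<close>, \<open>block_op\<close>, \<open>Vop\<close>, \<open>Qop\<close>, \<open>Pop\<close> is one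
  less than the one in the mathematical notation.\<close>

definition Hspace :: "(nat \<Rightarrow> nat \<Rightarrow> 'p) \<Rightarrow> nat \<Rightarrow> ('p \<Rightarrow> complex) set" where
  "Hspace x n = {f. \<forall>p. p \<notin> level x n \<longrightarrow> f p = 0}"

definition inner_H ::
  "(nat \<Rightarrow> nat \<Rightarrow> 'p) \<Rightarrow> nat \<Rightarrow> ('p \<Rightarrow> complex) \<Rightarrow> ('p \<Rightarrow> complex) \<Rightarrow> complex" where
  "inner_H x n f g = (\<Sum>p\<in>level x n. cnj (f p) * g p)"

definition ket :: "'p \<Rightarrow> 'p \<Rightarrow> complex" where
  "ket p = (\<lambda>q. if q = p then 1 else 0)"

definition fscale :: "complex \<Rightarrow> ('p \<Rightarrow> complex) \<Rightarrow> ('p \<Rightarrow> complex)" where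
  "fscale c f = (\<lambda>p. c * f p)"

definition Hsub :: "(nat \<Rightarrow> nat \<Rightarrow> 'p) \<Rightarrow> nat \<Rightarrow> nat \<Rightarrow> ('p \<Rightarrow> complex) set" where
  "Hsub x n j = {f \<in> Hspace x (n + 1). \<forall>p. p \<notin> {x (n + 1) (4 * j + k) | k. k < 4} \<longrightarrow> f p = 0}"

definition of_coords ::
  "(nat \<Rightarrow> nat \<Rightarrow> 'p) \<Rightarrow> nat \<Rightarrow> nat \<Rightarrow> complex list \<Rightarrow> ('p \<Rightarrow> complex)" where
  "of_coords x n j zs = (\<Sum>k<4. fscale (zs ! k) (ket (x (n + 1) (4 * j + k))))"

text \<open>The adjoint of \<open>A\<close> on \<open>H\<close>, determined on \<open>H\<close> only (cf. \<open>adjoint\<close> in HOL-Analysis).\<close>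

definition adjoint_on ::
  "('v \<Rightarrow> 'v \<Rightarrow> complex) \<Rightarrow> 'v set \<Rightarrow> ('v \<Rightarrow> 'v) \<Rightarrow> ('v \<Rightarrow> 'v)" where
  "adjoint_on ip H A =
     (SOME B. (\<forall>g\<in>H. B g \<in> H) \<and> (\<forall>f\<in>H. \<forall>g\<in>H. ip (A f) g = ip f (B g)))"

definition coupling_mat :: "(nat \<Rightarrow> complex) \<Rightarrow> complex mat" where
  "coupling_mat c = mat_of_rows_list 4
     [[c 0, c 1, c 2, c 3],
      [c 1, c 0, c 3, c 2],
      [c 2, c 3, c 0, c 1],
      [c 3, c 2, c 1, c 0]]"

text \<open>The operator on \<open>H\<^sub>n\<^sub>+\<^sub>1\<^sub>,\<^sub>j\<close> with matrix \<open>M\<close> in the ordered basis \<open>ket (x (n + 1) (4 * j + k))\<close>,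
  \<open>k < 4\<close>, and conversely the matrix of an operator in that basis.\<close>

definition block_op ::
  "(nat \<Rightarrow> nat \<Rightarrow> 'p) \<Rightarrow> nat \<Rightarrow> nat \<Rightarrow> complex mat \<Rightarrow> ('p \<Rightarrow> complex) \<Rightarrow> ('p \<Rightarrow> complex)" where
  "block_op x n j M f =
     (\<Sum>r<4. fscale (\<Sum>s<4. M $$ (r, s) * f (x (n + 1) (4 * j + s))) (ket (x (n + 1) (4 * j + r))))"

definition block_mat ::
  "(nat \<Rightarrow> nat \<Rightarrow> 'p) \<Rightarrow> nat \<Rightarrow> nat \<Rightarrow> (('p \<Rightarrow> complex) \<Rightarrow> ('p \<Rightarrow> complex)) \<Rightarrow> complex mat" where
  "block_mat x n j A =
     mat 4 4 (\<lambda>(r, s). inner_H x (n + 1) (ket (x (n + 1) (4 * j + r)))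
                                        (A (ket (x (n + 1) (4 * j + s)))))"

definition Vop ::
  "(nat \<Rightarrow> nat \<Rightarrow> 'p) \<Rightarrow> ('p \<Rightarrow> 'p \<Rightarrow> complex) \<Rightarrow> nat \<Rightarrow> nat \<Rightarrow> ('p \<Rightarrow> complex) \<Rightarrow> ('p \<Rightarrow> complex)" where
  "Vop x a n j = block_op x n j (coupling_mat (coupling x a n j))"

text \<open>\<open>digit_coord n k m\<close> is \<open>m\<^sup>k\<close> for \<open>m\<close> written with \<open>n\<close> base-4 digits.\<close>

definition digit_coord :: "nat \<Rightarrow> nat \<Rightarrow> nat \<Rightarrow> nat" where
  "digit_coord n k m = (\<Sum>i<n. (if (m div 4 ^ i) mod 4 = k then 1 else 0) * 4 ^ i)"

text \<open>\<open>Qop x n k\<close> is \<open>Q\<^sup>k\<close> on \<open>H\<^sub>n\<^sub>+\<^sub>1\<close>. It leaves \<open>H\<^sub>n\<^sub>+\<^sub>1\<^sub>,\<^sub>j\<close> invariant, and its restriction is obtained by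
  applying it to elements of \<open>Hsub x n j\<close> only.\<close>

definition Qop ::
  "(nat \<Rightarrow> nat \<Rightarrow> 'p) \<Rightarrow> nat \<Rightarrow> nat \<Rightarrow> ('p \<Rightarrow> complex) \<Rightarrow> ('p \<Rightarrow> complex)" where
  "Qop x n k f =
     (\<Sum>m<4 ^ n. fscale (of_nat (digit_coord n k m) * f (x (n + 1) m)) (ket (x (n + 1) m)))"

definition Pop ::
  "(nat \<Rightarrow> nat \<Rightarrow> 'p) \<Rightarrow> ('p \<Rightarrow> 'p \<Rightarrow> complex) \<Rightarrow> nat \<Rightarrow> nat \<Rightarrow> nat \<Rightarrow> ('p \<Rightarrow> complex) \<Rightarrow> ('p \<Rightarrow> complex)" where
  "Pop x a n j k =
     Vop x a n j \<circ> Qop x n k \<circ> adjoint_on (inner_H x (n + 1)) (Hsub x n j) (Vop x a n j)"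

definition commutator :: "('v::minus \<Rightarrow> 'v) \<Rightarrow> ('v \<Rightarrow> 'v) \<Rightarrow> ('v \<Rightarrow> 'v)" where
  "commutator A B = (\<lambda>f. A (B f) - B (A f))"

definition eigvec_on ::
  "('p \<Rightarrow> complex) set \<Rightarrow> (('p \<Rightarrow> complex) \<Rightarrow> ('p \<Rightarrow> complex)) \<Rightarrow> complex \<Rightarrow> ('p \<Rightarrow> complex) \<Rightarrow> bool" where
  "eigvec_on H A l v \<longleftrightarrow> v \<in> H \<and> v \<noteq> 0 \<and> A v = fscale l v"

definition eigvals_on ::
  "('p \<Rightarrow> complex) set \<Rightarrow> (('p \<Rightarrow> complex) \<Rightarrow> ('p \<Rightarrow> complex)) \<Rightarrow> complex set" where
  "eigvals_on H A = {l. \<exists>v. eigvec_on H A l v}"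

definition eigspace_on ::
  "('p \<Rightarrow> complex) set \<Rightarrow> (('p \<Rightarrow> complex) \<Rightarrow> ('p \<Rightarrow> complex)) \<Rightarrow> complex \<Rightarrow> ('p \<Rightarrow> complex) set" where
  "eigspace_on H A l = {v \<in> H. A v = fscale l v}"

end

theory Submission
  imports Defs
begin

text \<open>On \<open>H\<^sub>n\<^sub>+\<^sub>1\<^sub>,\<^sub>j\<close> the operator \<open>Q\<^sup>0\<close> is a scalar plus the projection onto the first basis vector
  \<open>e\<close>, because only the last base-4 digit of \<open>4 j + k\<close> depends on \<open>k\<close>. Since \<open>V\<close> is unitary and maps
  \<open>e\<close> to the unit vector \<open>u = (c\<^sup>0, c\<^sup>1, c\<^sup>2, c\<^sup>3)\<close>, the operator \<open>P\<^sup>0\<close> is the same scalar plus the projection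
  onto \<open>u\<close>. The scalars drop out of the commutator, which becomes that of two rank-one projections.\<close>

section \<open>Base-4 digits and complex identities\<close>

lemma vector_space_fscale: "vector_space (fscale :: complex \<Rightarrow> ('p \<Rightarrow> complex) \<Rightarrow> _)"
  by unfold_locales (auto simp: fscale_def fun_eq_iff algebra_simps)

lemma less_4_cases:
  assumes "k < (4 :: nat)"
  obtains "k = 0" | "k = 1" | "k = 2" | "k = 3"
  using assms by linarith

lemma sum_4: "(\<Sum>k<4. f k) = f 0 + f 1 + f 2 + f (3 :: nat)" for f :: "nat \<Rightarrow> 'a::comm_monoid_add"
  by (simp add: eval_nat_numeral add.assoc)

text \<open>Appending the digit \<open>r\<close> moves every digit of \<open>j\<close> up one place,
  hence the factor 4; only the new lowest place sees \<open>r\<close>.\<close>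

lemma digit_coord_last_digit:
  assumes "r < 4"
  shows "digit_coord (Suc m) k (4 * j + r) = (if r = k then 1 else 0) + 4 * digit_coord m k j"
proof -
  have "(4 * j + r) div (4 * 4 ^ i) = j div 4 ^ i" for i
    using assms by (simp add: div_mult2_eq)
  then have "((4 * j + r) div 4 ^ Suc i) mod 4 = (j div 4 ^ i) mod 4" for i
    by simp
  moreover have "(4 * j + r) mod 4 = r"
    using assms by simp
  ultimately show ?thesis
    by (simp only: digit_coord_def sum.lessThan_Suc_shift sum_distrib_left power_0 div_by_1 mult_1_right
      power_Suc mult.left_commute)
qed

lemma cnj_mult_eq_of_real: "cnj z * z = complex_of_real ((cmod z)\<^sup>2)"
  by (metis complex_norm_square mult.commute)

lemma sum_cnj_mult_eq_0_iff: "cnj z * z + cnj w * w = 0 \<longleftrightarrow> z = 0 \<and> w = 0"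
proof -
  have "cnj z * z + cnj w * w = complex_of_real ((cmod z)\<^sup>2 + (cmod w)\<^sup>2)"
    by (simp add: cnj_mult_eq_of_real)
  then show ?thesis
    by (simp only: of_real_eq_0_iff sum_power2_eq_zero_iff norm_eq_zero)
qed

text \<open>Expand \<open>(e + e') * cnj (e + e') = 1\<close>: the squared moduli already account
  for the 1, so the cross terms cancel.\<close>

lemma cnj_cross_sum_eq_0:
  assumes "e + e' = 1" "(cmod e)\<^sup>2 + (cmod e')\<^sup>2 = 1"
  shows "e * cnj e + e' * cnj e' = 1" "e * cnj e' + e' * cnj e = 0"
proof -
  show 1: "e * cnj e + e' * cnj e' = 1"
    using assms(2) by (metis complex_norm_square of_real_1 of_real_add)
  have "e * cnj e' + e' * cnj e = (e + e') * cnj (e + e') - (e * cnj e + e' * cnj e')"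
    by (simp add: algebra_simps)
  then show "e * cnj e' + e' * cnj e = 0"
    unfolding assms(1) 1 by simp
qed

section \<open>The coupling matrix and its unitarity\<close>

lemma coupling_mat_entries:
  "coupling_mat c $$ (0, 0) = c 0" "coupling_mat c $$ (0, 1) = c 1"
  "coupling_mat c $$ (0, 2) = c 2" "coupling_mat c $$ (0, 3) = c 3"
  "coupling_mat c $$ (1, 0) = c 1" "coupling_mat c $$ (1, 1) = c 0"
  "coupling_mat c $$ (1, 2) = c 3" "coupling_mat c $$ (1, 3) = c 2"
  "coupling_mat c $$ (2, 0) = c 2" "coupling_mat c $$ (2, 1) = c 3"
  "coupling_mat c $$ (2, 2) = c 0" "coupling_mat c $$ (2, 3) = c 1"
  "coupling_mat c $$ (3, 0) = c 3" "coupling_mat c $$ (3, 1) = c 2"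
  "coupling_mat c $$ (3, 2) = c 1" "coupling_mat c $$ (3, 3) = c 0"
  by (simp_all add: coupling_mat_def mat_of_rows_list_def)

lemma coupling_mat_first_column:
  assumes "r < 4"
  shows "coupling_mat c $$ (r, 0) = c r"
  using assms by (rule less_4_cases) (simp_all only: coupling_mat_entries)

text \<open>The matrix is the Kronecker product of the 2 x 2 matrices with rows
  \<open>(f0, f1), (f1, f0)\<close> and \<open>(e0, e1), (e1, e0)\<close>. Each inner product of
  rows therefore factors into an \<open>e\<close>-sum and an \<open>f\<close>-sum, both known from
  \<open>cnj_cross_sum_eq_0\<close>.\<close>

lemma coupling_mat_rows_orthonormal:
  assumes ee: "e0 + e1 = 1" "(cmod e0)\<^sup>2 + (cmod e1)\<^sup>2 = 1"
    and ff: "f0 + f1 = 1" "(cmod f0)\<^sup>2 + (cmod f1)\<^sup>2 = 1"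
    and c: "c 0 = e0 * f0" "c 1 = e1 * f0" "c 2 = e0 * f1" "c 3 = e1 * f1"
    and rt: "r < 4" "t < 4"
  shows "(\<Sum>s<4. coupling_mat c $$ (r, s) * cnj (coupling_mat c $$ (t, s))) = (if r = t then 1 else 0)"
proof -
  note e = cnj_cross_sum_eq_0[OF ee] and f = cnj_cross_sum_eq_0[OF ff]
  have "c 0 * cnj (c 0) + c 1 * cnj (c 1) + c 2 * cnj (c 2) + c 3 * cnj (c 3)
      = (e0 * cnj e0 + e1 * cnj e1) * (f0 * cnj f0 + f1 * cnj f1)"
    unfolding c by (simp add: algebra_simps)
  then have 0: "c 0 * cnj (c 0) + c 1 * cnj (c 1) + c 2 * cnj (c 2) + c 3 * cnj (c 3) = 1"
    by (simp add: e f)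
  have "c 0 * cnj (c 1) + c 1 * cnj (c 0) + c 2 * cnj (c 3) + c 3 * cnj (c 2)
      = (e0 * cnj e1 + e1 * cnj e0) * (f0 * cnj f0 + f1 * cnj f1)"
    unfolding c by (simp add: algebra_simps)
  then have 1: "c 0 * cnj (c 1) + c 1 * cnj (c 0) + c 2 * cnj (c 3) + c 3 * cnj (c 2) = 0"
    by (simp add: e f)
  have "c 0 * cnj (c 2) + c 1 * cnj (c 3) + c 2 * cnj (c 0) + c 3 * cnj (c 1)
      = (e0 * cnj e0 + e1 * cnj e1) * (f0 * cnj f1 + f1 * cnj f0)"
    unfolding c by (simp add: algebra_simps)
  then have 2: "c 0 * cnj (c 2) + c 1 * cnj (c 3) + c 2 * cnj (c 0) + c 3 * cnj (c 1) = 0"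
    by (simp add: e f)
  have "c 0 * cnj (c 3) + c 1 * cnj (c 2) + c 2 * cnj (c 1) + c 3 * cnj (c 0)
      = (e0 * cnj e1 + e1 * cnj e0) * (f0 * cnj f1 + f1 * cnj f0)"
    unfolding c by (simp add: algebra_simps)
  then have 3: "c 0 * cnj (c 3) + c 1 * cnj (c 2) + c 2 * cnj (c 1) + c 3 * cnj (c 0) = 0"
    by (simp add: e f)
  have neq: "(0 :: nat) \<noteq> 1" "(0 :: nat) \<noteq> 2" "(0 :: nat) \<noteq> 3" "(1 :: nat) \<noteq> 2" "(1 :: nat) \<noteq> 3" "(2 :: nat) \<noteq> 3"
    by simp_all
  \<comment> \<open>The entry at \<open>(r, s)\<close> is \<open>c\<close> at the bitwise exclusive
    or of \<open>r\<close> and \<open>s\<close>. The sixteen sums thus depend only on the exclusive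
    or of \<open>r\<close> and \<open>t\<close> and are rearrangements of the four above.\<close>
  show ?thesis
    by (rule less_4_cases[OF rt(1)]; rule less_4_cases[OF rt(2)];
      simp only: sum_4 coupling_mat_entries neq neq[symmetric] refl if_True if_False;
      insert 0 1 2 3; simp only: add.assoc add.commute add.left_commute)
qed

section \<open>Pointwise sums and the determinant of an arrow matrix\<close>

lemma sum_fun_apply: "(\<Sum>i\<in>A. f i) p = (\<Sum>i\<in>A. f i p)"
  for f :: "'i \<Rightarrow> 'a \<Rightarrow> 'b::comm_monoid_add"
  by (induction A rule: infinite_finite_induct) auto

text \<open>Laplace expansion along the first column, with the minors again in the form
  \<open>mat\<close> of a function, so that it can be unfolded repeatedly.\<close>

lemma det_mat_Suc:
  fixes f :: "nat \<times> nat \<Rightarrow> 'a :: comm_ring_1"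
  shows "det (mat (Suc m) (Suc m) f) = (\<Sum>i<Suc m. (- 1) ^ i * f (i, 0) *
    det (mat m m (\<lambda>(r, s). f (if r < i then r else Suc r, Suc s))))"
proof -
  have "mat_delete (mat (Suc m) (Suc m) f) i 0 =
      mat m m (\<lambda>(r, s). f (if r < i then r else Suc r, Suc s))" if "i < Suc m" for i
    by (rule eq_matI) (use that in \<open>auto simp: mat_delete_def\<close>)
  then show ?thesis
    by (subst laplace_expansion_column[where j = 0])
      (auto simp: cofactor_def intro!: sum.cong)
qed

text \<open>Outside the first row and column only the diagonal survives, so only the identity and
  the transpositions of 0 with 1, 2, 3 contribute.\<close>

lemma det_arrow_4:
  fixes t :: "'a :: comm_ring_1"
  shows "det (mat 4 4 (\<lambda>(r, s). if r = s then t else if r = 0 then b s else if s = 0 then d r else 0))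
    = t ^ 4 - t\<^sup>2 * (b 1 * d 1 + b 2 * d 2 + b 3 * d 3)"
proof -
  have 4: "4 = Suc (Suc (Suc (Suc 0)))"
    by simp
  show ?thesis
    unfolding 4 det_mat_Suc
    by (simp add: eval_nat_numeral algebra_simps)
qed

section \<open>Coordinates, adjoints and the operator \<open>Q\<close> on the block\<close>

locale block =
  fixes x :: "nat \<Rightarrow> nat \<Rightarrow> 'p" and n j :: nat
  assumes labelling: "poset_labelling x" and n_pos: "n \<ge> 1" and j_less: "j < 4 ^ (n - 1)"
begin

text \<open>\<open>Suc n\<close> is the simplifier's normal form of \<open>n + 1\<close>, so facts
  about \<open>y\<close> match simplified goals.\<close>

definition y :: "nat \<Rightarrow> 'p" where "y k = x (Suc n) (4 * j + k)"

lemma of_coords_eq: "of_coords x n j zs = (\<Sum>k<4. fscale (zs ! k) (ket (y k)))"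
  by (simp add: of_coords_def y_def)

lemma block_op_eq:
  "block_op x n j M f = (\<Sum>r<4. fscale (\<Sum>s<4. M $$ (r, s) * f (y s)) (ket (y r)))"
  by (simp add: block_op_def y_def)

lemma index_less: "k < 4 \<Longrightarrow> 4 * j + k < 4 ^ n"
  using j_less n_pos by (cases n) auto

lemma label_eq_iff:
  assumes "m < 4 ^ n" "m' < 4 ^ n"
  shows "x (Suc n) m = x (Suc n) m' \<longleftrightarrow> m = m'"
proof -
  have "inj_on (x (Suc n)) {..<4 ^ n}"
    using labelling[unfolded poset_labelling_def, THEN conjunct1, rule_format, of "Suc n"] by simp
  then show ?thesis
    using assms by (simp add: inj_on_eq_iff)
qed

lemma y_eq_iff: "k < 4 \<Longrightarrow> l < 4 \<Longrightarrow> y k = y l \<longleftrightarrow> k = l"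
  using label_eq_iff[of "4 * j + k" "4 * j + l"] index_less by (simp add: y_def)

lemma y_in_level: "k < 4 \<Longrightarrow> y k \<in> level x (Suc n)"
  using index_less by (simp add: level_def y_def)

lemma Hsub_iff: "f \<in> Hsub x n j \<longleftrightarrow> (\<forall>p. p \<notin> y ` {..<4} \<longrightarrow> f p = 0)"
proof -
  have "{x (n + 1) (4 * j + k) | k. k < 4} = y ` {..<4}"
    by (auto simp: y_def)
  moreover have "y ` {..<4} \<subseteq> level x (n + 1)"
    using y_in_level by auto
  ultimately show ?thesis
    unfolding Hsub_def Hspace_def by blast
qed

lemma Hsub_ext:
  assumes "f \<in> Hsub x n j" "g \<in> Hsub x n j" "\<And>k. k < 4 \<Longrightarrow> f (y k) = g (y k)"
  shows "f = g"
proof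
  fix p
  show "f p = g p"
    using assms by (cases "p \<in> y ` {..<4}") (auto simp: Hsub_iff)
qed

lemma ket_y:
  assumes "k < 4" "l < 4"
  shows "ket (y k) (y l) = (if l = k then 1 else 0)"
  using y_eq_iff[OF assms(2,1)] by (simp add: ket_def)

lemma sum_ket_y:
  assumes "k < 4"
  shows "(\<Sum>l<4. fscale (z l) (ket (y l))) (y k) = z k"
proof -
  have "(\<Sum>l<4. fscale (z l) (ket (y l))) (y k) = (\<Sum>l<4. if k = l then z l else 0)"
    unfolding sum_fun_apply by (rule sum.cong) (simp_all add: assms fscale_def ket_y)
  then show ?thesis
    using assms by (simp add: sum.delta')
qed

lemma sum_ket_in_Hsub: "(\<Sum>l<4. fscale (z l) (ket (y l))) \<in> Hsub x n j"
  by (auto simp: Hsub_iff sum_fun_apply fscale_def ket_def intro!: sum.neutral)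

lemma of_coords_y: "k < 4 \<Longrightarrow> of_coords x n j zs (y k) = zs ! k"
  unfolding of_coords_eq by (rule sum_ket_y)

lemma of_coords_in_Hsub: "of_coords x n j zs \<in> Hsub x n j"
  unfolding of_coords_eq by (rule sum_ket_in_Hsub)

lemma Hsub_eqI:
  assumes "f \<in> Hsub x n j" "g \<in> Hsub x n j"
    and "f (y 0) = g (y 0)" "f (y 1) = g (y 1)" "f (y 2) = g (y 2)" "f (y 3) = g (y 3)"
  shows "f = g"
  using assms by (intro Hsub_ext) (auto elim!: less_4_cases)

lemma zero_in_Hsub: "0 \<in> Hsub x n j"
  by (simp add: Hsub_iff)

lemma of_coords_eq_0_iff:
  "of_coords x n j [z0, z1, z2, z3] = 0 \<longleftrightarrow> z0 = 0 \<and> z1 = 0 \<and> z2 = 0 \<and> z3 = 0" (is "?v = 0 \<longleftrightarrow> _")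
proof -
  have "?v = 0 \<longleftrightarrow> ?v (y 0) = 0 \<and> ?v (y 1) = 0 \<and> ?v (y 2) = 0 \<and> ?v (y 3) = 0"
    using Hsub_eqI[OF of_coords_in_Hsub zero_in_Hsub] by auto
  then show ?thesis
    by (simp add: of_coords_y)
qed

lemma inner_H_Hsub:
  assumes "f \<in> Hsub x n j"
  shows "inner_H x (Suc n) f g = (\<Sum>k<4. cnj (f (y k)) * g (y k))"
proof -
  have "inner_H x (Suc n) f g = (\<Sum>p\<in>y ` {..<4}. cnj (f p) * g p)"
    unfolding inner_H_def
    by (rule sum.mono_neutral_right) (use assms y_in_level in \<open>auto simp: Hsub_iff level_def\<close>)
  also have "\<dots> = (\<Sum>k<4. cnj (f (y k)) * g (y k))"
    by (subst sum.reindex) (auto simp: inj_on_def y_eq_iff)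
  finally show ?thesis .
qed

lemma ket_y_in_Hsub: "k < 4 \<Longrightarrow> ket (y k) \<in> Hsub x n j"
  by (auto simp: Hsub_iff ket_def)

lemma inner_H_ket_y:
  assumes "k < 4"
  shows "inner_H x (Suc n) (ket (y k)) g = g (y k)"
proof -
  have "(\<Sum>l<4. cnj (ket (y k) (y l)) * g (y l)) = (\<Sum>l<4. if l = k then g (y l) else 0)"
    by (rule sum.cong) (simp_all add: assms ket_y)
  then show ?thesis
    using assms by (simp add: inner_H_Hsub ket_y_in_Hsub)
qed

lemma block_op_in_Hsub: "block_op x n j M f \<in> Hsub x n j"
  unfolding block_op_eq by (rule sum_ket_in_Hsub)

lemma block_op_y: "r < 4 \<Longrightarrow> block_op x n j M f (y r) = (\<Sum>s<4. M $$ (r, s) * f (y s))"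
  unfolding block_op_eq by (rule sum_ket_y)

text \<open>Since \<open>adjoint_on\<close> is a choice, the conjugate transpose \<open>?N\<close>
  first shows that an adjoint exists; the adjoint property tested on basis kets then fixes the
  coordinates of whichever map was chosen, for arguments in the block.\<close>

lemma adjoint_on_block_op:
  fixes M
  defines "B \<equiv> adjoint_on (inner_H x (Suc n)) (Hsub x n j) (block_op x n j M)"
  assumes g: "g \<in> Hsub x n j"
  shows "B g \<in> Hsub x n j"
    and "r < 4 \<Longrightarrow> B g (y r) = (\<Sum>s<4. cnj (M $$ (s, r)) * g (y s))"
proof -
  let ?H = "Hsub x n j" and ?ip = "inner_H x (Suc n)" and ?A = "block_op x n j M"
  let ?N = "mat 4 4 (\<lambda>(r, s). cnj (M $$ (s, r)))"
  have "?ip (?A f) g = ?ip f (block_op x n j ?N g)" if "f \<in> ?H" "g \<in> ?H" for f g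
    using that
    by (simp add: inner_H_Hsub block_op_in_Hsub block_op_y sum_4 algebra_simps)
  then have "\<exists>B. (\<forall>g\<in>?H. B g \<in> ?H) \<and> (\<forall>f\<in>?H. \<forall>g\<in>?H. ?ip (?A f) g = ?ip f (B g))"
    by (intro exI[of _ "block_op x n j ?N"]) (simp add: block_op_in_Hsub)
  then have B: "(\<forall>g\<in>?H. B g \<in> ?H) \<and> (\<forall>f\<in>?H. \<forall>g\<in>?H. ?ip (?A f) g = ?ip f (B g))"
    unfolding B_def adjoint_on_def by (rule someI_ex)
  then show "B g \<in> ?H"
    using g by blast
  show "B g (y r) = (\<Sum>s<4. cnj (M $$ (s, r)) * g (y s))" if r: "r < 4"
  proof -
    have "(\<Sum>t<4. M $$ (s, t) * ket (y r) (y t)) = M $$ (s, r)" for s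
    proof -
      have "(\<Sum>t<4. M $$ (s, t) * ket (y r) (y t)) = (\<Sum>t<4. if t = r then M $$ (s, t) else 0)"
        by (rule sum.cong) (simp_all add: r ket_y)
      then show ?thesis
        using r by simp
    qed
    then have "?ip (?A (ket (y r))) g = (\<Sum>s<4. cnj (M $$ (s, r)) * g (y s))"
      by (simp add: inner_H_Hsub block_op_in_Hsub block_op_y)
    moreover have "?ip (?A (ket (y r))) g = B g (y r)"
      using B g r by (simp add: ket_y_in_Hsub inner_H_ket_y)
    ultimately show ?thesis
      by simp
  qed
qed

lemma Qop_label:
  assumes "m < 4 ^ n"
  shows "Qop x n k f (x (Suc n) m) = of_nat (digit_coord n k m) * f (x (Suc n) m)"
proof -
  have "Qop x n k f (x (Suc n) m) =
      (\<Sum>l<4 ^ n. if l = m then of_nat (digit_coord n k l) * f (x (Suc n) l) else 0)"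
    unfolding Qop_def sum_fun_apply
    by (rule sum.cong) (simp_all add: assms label_eq_iff fscale_def ket_def eq_commute)
  then show ?thesis
    using assms by simp
qed

text \<open>The digits of \<open>j\<close> are common to all four labels of the block and contribute
  one scalar; the last digit contributes the projection onto basis vector \<open>k\<close>.\<close>

lemma Qop_y:
  assumes "r < 4"
  shows "Qop x n k f (y r) =
    ((if r = k then 1 else 0) + 4 * of_nat (digit_coord (n - 1) k j)) * f (y r)"
  using digit_coord_last_digit[OF assms, of "n - 1" k j] n_pos assms
  by (simp add: Qop_label index_less y_def)

lemma Qop_in_Hsub:
  assumes "f \<in> Hsub x n j"
  shows "Qop x n k f \<in> Hsub x n j"
proof -
  have "Qop x n k f p = 0" if p: "p \<notin> y ` {..<4}" for p
  \<comment> \<open>On the level \<open>Qop\<close> is diagonal and \<open>f\<close> vanishes off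
    the block; off the level every ket in the defining sum vanishes.\<close>
  proof (cases "p \<in> x (Suc n) ` {..<4 ^ n}")
    case True
    then show ?thesis
      using assms p by (auto simp: Qop_label Hsub_iff)
  next
    case False
    then show ?thesis
      by (auto simp: Qop_def sum_fun_apply fscale_def ket_def intro!: sum.neutral)
  qed
  then show ?thesis
    by (simp add: Hsub_iff)
qed

end

section \<open>The momentum operator and the commutator on the block\<close>

locale coupled_block = block x n j for x :: "nat \<Rightarrow> nat \<Rightarrow> 'p" and n j :: nat +
  fixes a :: "'p \<Rightarrow> 'p \<Rightarrow> complex"
  assumes product: "product_coupling x a"
begin

abbreviation c :: "nat \<Rightarrow> complex" where "c \<equiv> coupling x a n j"

abbreviation K :: "('p \<Rightarrow> complex) \<Rightarrow> ('p \<Rightarrow> complex)" where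
  "K \<equiv> commutator (Qop x n 0) (Pop x a n j 0)"

text \<open>The inner product of \<open>f\<close> with the unit vector
  \<open>u = (c 0, c 1, c 2, c 3)\<close>, the image of the first basis vector under
  \<open>Vop\<close>.\<close>

abbreviation overlap :: "('p \<Rightarrow> complex) \<Rightarrow> complex" where
  "overlap f \<equiv> (\<Sum>s<4. cnj (c s) * f (y s))"

lemma coupling_rows:
  assumes "r < 4" "t < 4"
  shows "(\<Sum>s<4. coupling_mat c $$ (r, s) * cnj (coupling_mat c $$ (t, s))) = (if r = t then 1 else 0)"
proof -
  obtain e0 e1 f0 f1 where "e0 + e1 = 1" "(cmod e0)\<^sup>2 + (cmod e1)\<^sup>2 = 1"
    "f0 + f1 = 1" "(cmod f0)\<^sup>2 + (cmod f1)\<^sup>2 = 1"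
    "c 0 = e0 * f0" "c 1 = e1 * f0" "c 2 = e0 * f1" "c 3 = e1 * f1"
    using product n_pos j_less unfolding product_coupling_def by metis
  then show ?thesis
    using assms by (rule coupling_mat_rows_orthonormal)
qed

lemma coupling_norm: "c 0 * cnj (c 0) + c 1 * cnj (c 1) + c 2 * cnj (c 2) + c 3 * cnj (c 3) = 1"
  using coupling_rows[of 0 0] by (simp add: sum_4 coupling_mat_entries coupling_mat_entries(2)[simplified])

text \<open>Both sides equal \<open>e0 * e1 * f0 * f1\<close>. With \<open>c 0\<close> nonzero this
  excludes \<open>c 1 = c 2 = 0\<close> together with a nonzero \<open>c 3\<close>, where the
  explicit kernel vectors below would degenerate.\<close>

lemma coupling_product_relation: "c 0 * c 3 = c 1 * c 2"
  using product n_pos j_less unfolding product_coupling_def by (metis mult.assoc mult.commute)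

lemma Pop_in_Hsub: "Pop x a n j 0 f \<in> Hsub x n j"
  by (simp add: Pop_def Vop_def block_op_in_Hsub)

text \<open>Conjugating scalar plus projection by \<open>V\<close> keeps the scalar, because
  \<open>V\<close> times its adjoint is the identity, and moves the projection to
  \<open>u\<close>.\<close>

lemma Pop_y:
  assumes f: "f \<in> Hsub x n j" and r: "r < 4"
  shows "Pop x a n j 0 f (y r) = c r * overlap f + 4 * of_nat (digit_coord (n - 1) 0 j) * f (y r)"
proof -
  let ?C = "\<lambda>r s. coupling_mat c $$ (r, s)" and ?d = "4 * of_nat (digit_coord (n - 1) 0 j) :: complex"
  have "Pop x a n j 0 f (y r) = (\<Sum>s<4. ?C r s *
      (((if s = 0 then 1 else 0) + ?d) * (\<Sum>t<4. cnj (?C t s) * f (y t))))"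
    using adjoint_on_block_op[OF f] r by (simp add: Pop_def Vop_def block_op_y Qop_y)
  \<comment> \<open>The term \<open>s = 0\<close> carries the projection, the rest the scalar
    \<open>?d\<close>.\<close>
  also have "\<dots> = (\<Sum>s<4. if s = 0 then ?C r s * (\<Sum>t<4. cnj (?C t s) * f (y t)) else 0)
      + ?d * (\<Sum>s<4. \<Sum>t<4. ?C r s * cnj (?C t s) * f (y t))"
    unfolding sum_distrib_left sum.distrib[symmetric]
    by (intro sum.cong) (auto simp: sum_distrib_left sum.distrib algebra_simps)
  also have "(\<Sum>s<4. if s = 0 then ?C r s * (\<Sum>t<4. cnj (?C t s) * f (y t)) else 0) = c r * overlap f"
    using r by (simp add: coupling_mat_first_column)
  \<comment> \<open>Exchanging the sums exposes the inner products of rows of the coupling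
    matrix.\<close>
  also have "(\<Sum>s<4. \<Sum>t<4. ?C r s * cnj (?C t s) * f (y t))
      = (\<Sum>t<4. (\<Sum>s<4. ?C r s * cnj (?C t s)) * f (y t))"
    by (subst sum.swap) (simp add: sum_distrib_right)
  also have "\<dots> = (\<Sum>t<4. if t = r then f (y t) else 0)"
    by (rule sum.cong) (use r in \<open>auto simp: coupling_rows\<close>)
  also have "\<dots> = f (y r)"
    using r by simp
  finally show ?thesis .
qed

lemma K_in_Hsub:
  assumes "f \<in> Hsub x n j"
  shows "K f \<in> Hsub x n j"
  using Qop_in_Hsub[OF Pop_in_Hsub[of f], of 0] Pop_in_Hsub[of "Qop x n 0 f"]
  by (simp add: commutator_def Hsub_iff)

text \<open>For the rank-one projections onto the first basis vector \<open>e\<close> and onto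
  \<open>u\<close>, whose inner product is \<open>c 0\<close>, the commutator sends \<open>f\<close>
  to \<open>c 0 * overlap f\<close> times \<open>e\<close> minus \<open>cnj (c 0) * f (y 0)\<close>
  times \<open>u\<close>.\<close>

lemma K_y:
  assumes f: "f \<in> Hsub x n j" and r: "r < 4"
  shows "K f (y r) = (if r = 0 then c 0 * overlap f else 0) - cnj (c 0) * f (y 0) * c r"
proof -
  have "overlap (Qop x n 0 f) =
      cnj (c 0) * f (y 0) + 4 * of_nat (digit_coord (n - 1) 0 j) * overlap f"
    using Qop_y[of 0 0 f] Qop_y[of 1 0 f] Qop_y[of 2 0 f] Qop_y[of 3 0 f]
    by (simp add: sum_4 algebra_simps)
  then show ?thesis
    using r by (auto simp: commutator_def Qop_y Pop_y f Qop_in_Hsub algebra_simps)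
qed

text \<open>What remains of \<open>overlap f\<close> in the first coordinate of \<open>K f\<close>,
  where the two terms \<open>c 0 * cnj (c 0) * f (y 0)\<close> cancel.\<close>

abbreviation tail_overlap :: "('p \<Rightarrow> complex) \<Rightarrow> complex" where
  "tail_overlap f \<equiv> cnj (c 1) * f (y 1) + cnj (c 2) * f (y 2) + cnj (c 3) * f (y 3)"

abbreviation tail_norm :: complex where
  "tail_norm \<equiv> cnj (c 1) * c 1 + cnj (c 2) * c 2 + cnj (c 3) * c 3"

lemma tail_norm_eq: "tail_norm = 1 - cnj (c 0) * c 0"
  using coupling_norm by (simp add: algebra_simps)

text \<open>Ensures that the square root in \<open>lp\<close> and \<open>lm\<close> is taken of a
  nonnegative number.\<close>

lemma cmod_c0_le_1: "(cmod (c 0))\<^sup>2 \<le> 1"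
proof -
  have "complex_of_real ((cmod (c 0))\<^sup>2 + (cmod (c 1))\<^sup>2 + (cmod (c 2))\<^sup>2 + (cmod (c 3))\<^sup>2) = 1"
    using tail_norm_eq unfolding cnj_mult_eq_of_real by (simp add: algebra_simps)
  then have "(cmod (c 0))\<^sup>2 + (cmod (c 1))\<^sup>2 + (cmod (c 2))\<^sup>2 + (cmod (c 3))\<^sup>2 = 1"
    by (metis of_real_eq_1_iff)
  then show ?thesis
    using zero_le_power2[of "cmod (c 1)"] zero_le_power2[of "cmod (c 2)"] zero_le_power2[of "cmod (c 3)"]
    by linarith
qed

text \<open>Isolates the degenerate case: there \<open>u\<close> is a multiple of the first basis
  vector and the commutator vanishes.\<close>

lemma tail_norm_eq_0_iff: "tail_norm = 0 \<longleftrightarrow> cmod (c 0) = 1"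
proof -
  have "tail_norm = complex_of_real (1 - (cmod (c 0))\<^sup>2)"
    by (subst tail_norm_eq) (simp add: cnj_mult_eq_of_real)
  then have "tail_norm = 0 \<longleftrightarrow> (cmod (c 0))\<^sup>2 = 1"
    by (simp only: of_real_eq_0_iff) auto
  then show ?thesis
    using norm_ge_zero[of "c 0"] unfolding power2_eq_1_iff by linarith
qed

section \<open>Eigenvalues, eigenvectors and the characteristic polynomial\<close>

lemma fscale_in_Hsub: "f \<in> Hsub x n j \<Longrightarrow> fscale l f \<in> Hsub x n j"
  by (simp add: Hsub_iff fscale_def)

lemma K_eq_fscale_iff:
  assumes f: "f \<in> Hsub x n j"
  shows "K f = fscale l f \<longleftrightarrow> c 0 * tail_overlap f = l * f (y 0) \<and>
    (\<forall>r\<in>{1, 2, 3}. - cnj (c 0) * f (y 0) * c r = l * f (y r))"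
proof -
  have "K f = fscale l f \<longleftrightarrow> (\<forall>r\<in>{0, 1, 2, 3}. K f (y r) = l * f (y r))"
    using Hsub_eqI[OF K_in_Hsub[OF f] fscale_in_Hsub[OF f, of l]] by (auto simp: fscale_def)
  then show ?thesis
    by (simp add: K_y f sum_4 algebra_simps)
qed

text \<open>Multiply the first coordinate equation by \<open>l\<close> and substitute the other
  three. The factor \<open>v (y 0)\<close> cancels: were it 0, those three would force
  \<open>v = 0\<close> as \<open>l\<close> is nonzero.\<close>

lemma eigval_square:
  assumes "eigvec_on (Hsub x n j) K l v" "l \<noteq> 0"
  shows "l\<^sup>2 = - (cnj (c 0) * c 0) * tail_norm"
proof -
  have v: "v \<in> Hsub x n j" "v \<noteq> 0"
    and 0: "c 0 * tail_overlap v = l * v (y 0)"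
    and 123: "- cnj (c 0) * v (y 0) * c 1 = l * v (y 1)"
      "- cnj (c 0) * v (y 0) * c 2 = l * v (y 2)" "- cnj (c 0) * v (y 0) * c 3 = l * v (y 3)"
    using assms(1) K_eq_fscale_iff[of v l] by (auto simp: eigvec_on_def)
  have "v (y 0) \<noteq> 0"
  proof
    assume "v (y 0) = 0"
    then have "v = 0"
      using 123 assms(2) v(1) by (intro Hsub_eqI zero_in_Hsub) auto
    then show False
      using v(2) by simp
  qed
  moreover have "l\<^sup>2 * v (y 0) = c 0 *
      (cnj (c 1) * (l * v (y 1)) + cnj (c 2) * (l * v (y 2)) + cnj (c 3) * (l * v (y 3)))"
  proof -
    have "l\<^sup>2 * v (y 0) = l * (c 0 * tail_overlap v)"
      by (simp only: 0 power2_eq_square mult.assoc)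
    then show ?thesis
      by (simp add: algebra_simps)
  qed
  then have "l\<^sup>2 * v (y 0) = - (cnj (c 0) * c 0) * tail_norm * v (y 0)"
    unfolding 123[symmetric] by (simp add: algebra_simps)
  ultimately show ?thesis
    by (rule mult_right_cancel[THEN iffD1])
qed

text \<open>Putting \<open>l\<close> in the first coordinate makes the last three equations hold
  identically; the first becomes the condition on \<open>l\<close> squared.\<close>

lemma K_nonzero_eigvec:
  assumes "l\<^sup>2 = - (cnj (c 0) * c 0) * tail_norm"
  defines "v \<equiv> of_coords x n j [l, - cnj (c 0) * c 1, - cnj (c 0) * c 2, - cnj (c 0) * c 3]"
  shows "K v = fscale l v"
  using assms(1) of_coords_in_Hsub
  by (subst K_eq_fscale_iff) (simp_all add: v_def of_coords_y power2_eq_square algebra_simps)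

lemma K_kernel_vec:
  assumes "a' * cnj (c 1) + b' * cnj (c 2) + c' * cnj (c 3) = 0"
  shows "K (of_coords x n j [0, a', b', c']) = fscale 0 (of_coords x n j [0, a', b', c'])"
  using assms of_coords_in_Hsub
  by (subst K_eq_fscale_iff) (simp_all add: of_coords_y algebra_simps)

lemma inner_H_of_coords:
  "inner_H x (Suc n) (of_coords x n j zs) (of_coords x n j ws) = (\<Sum>k<4. cnj (zs ! k) * ws ! k)"
  by (simp add: inner_H_Hsub of_coords_in_Hsub of_coords_y)

text \<open>The matrix of \<open>K\<close> has zero diagonal, since the two terms at
  \<open>(0, 0)\<close> cancel, and is zero outside the first row and column; its characteristic
  matrix is therefore of arrow form.\<close>

lemma char_poly_K:
  "char_poly (block_mat x n j K) =
    [:0, 1:] ^ 4 + [:0, 1:]\<^sup>2 * [:cnj (c 0) * c 0 * tail_norm:]"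
proof -
  let ?b = "\<lambda>s. [:- (c 0 * cnj (c s)):]" and ?d = "\<lambda>r. [:cnj (c 0) * c r:]"
  have "overlap (ket (y s)) = cnj (c s)" if "s < 4" for s
  proof -
    have "overlap (ket (y s)) = (\<Sum>t<4. if t = s then cnj (c t) else 0)"
      by (rule sum.cong) (simp_all add: that ket_y)
    then show ?thesis
      using that by simp
  qed
  then have entry: "block_mat x n j K $$ (r, s) =
      (if r = 0 then c 0 * cnj (c s) else 0) - (if s = 0 then cnj (c 0) * c r else 0)"
    if "r < 4" "s < 4" for r s
    using that by (simp add: block_mat_def inner_H_ket_y K_y ket_y_in_Hsub ket_y flip: y_def)
  have "block_mat x n j K \<in> carrier_mat 4 4"
    by (simp add: block_mat_def)
  then have "char_poly_matrix (block_mat x n j K) = mat 4 4 (\<lambda>(r, s).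
      if r = s then [:0, 1:] else if r = 0 then ?b s else if s = 0 then ?d r else 0)"
    by (intro eq_matI) (auto simp: char_poly_matrix_def entry mult.commute)
  then have "char_poly (block_mat x n j K) =
      [:0, 1:] ^ 4 - [:0, 1:]\<^sup>2 * (?b 1 * ?d 1 + ?b 2 * ?d 2 + ?b 3 * ?d 3)"
    unfolding char_poly_def by (simp only: det_arrow_4)
  also have "?b 1 * ?d 1 + ?b 2 * ?d 2 + ?b 3 * ?d 3 = - [:cnj (c 0) * c 0 * tail_norm:]"
    by (simp add: algebra_simps)
  finally show ?thesis
    by simp
qed

section \<open>The kernel of the commutator\<close>

text \<open>With \<open>w\<close> the vector of conjugates of \<open>(c 1, c 2, c 3)\<close>, the second vector is the cross
  product of \<open>w\<close> with the conjugate of the first.\<close>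

abbreviation kernel_vec1 :: "'p \<Rightarrow> complex" where
  "kernel_vec1 \<equiv> of_coords x n j [0, cnj (c 2), - cnj (c 1), 0]"

abbreviation kernel_vec2 :: "'p \<Rightarrow> complex" where
  "kernel_vec2 \<equiv> of_coords x n j
    [0, cnj (c 3) * c 1, cnj (c 3) * c 2, - (cnj (c 1) * c 1 + cnj (c 2) * c 2)]"

text \<open>Shows that the pairs described for the eigenvalue 0 exist, so that the claim about all
  such pairs is not vacuous.\<close>

lemma ex_orthogonal_kernel_vecs:
  assumes "c 0 \<noteq> 0"
  shows "\<exists>a1 b1 c1 a2 b2 c2.
    a1 * cnj (c 1) + b1 * cnj (c 2) + c1 * cnj (c 3) = 0 \<and>
    a2 * cnj (c 1) + b2 * cnj (c 2) + c2 * cnj (c 3) = 0 \<and>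
    inner_H x (Suc n) (of_coords x n j [0, a1, b1, c1]) (of_coords x n j [0, a2, b2, c2]) = 0 \<and>
    of_coords x n j [0, a1, b1, c1] \<noteq> 0 \<and> of_coords x n j [0, a2, b2, c2] \<noteq> 0"
proof (cases "c 1 = 0 \<and> c 2 = 0")
  case True
  then have "c 3 = 0"
    using coupling_product_relation assms by simp
  \<comment> \<open>All three coefficients vanish, so the linear condition is void and two standard
    basis vectors serve.\<close>
  with True show ?thesis
    by (intro exI[of _ 1] exI[of _ 0] exI[of _ 0] exI[of _ 0] exI[of _ 1] exI[of _ 0])
      (simp add: inner_H_of_coords of_coords_eq_0_iff sum_4)
next
  case False
  let ?N = "cnj (c 1) * c 1 + cnj (c 2) * c 2"
  have "?N \<noteq> 0"
    using False sum_cnj_mult_eq_0_iff by blast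
  then have "kernel_vec2 \<noteq> 0"
    by (simp only: of_coords_eq_0_iff neg_equal_0_iff_equal simp_thms)
  moreover have "kernel_vec1 \<noteq> 0"
    using False by (auto simp: of_coords_eq_0_iff)
  moreover have "inner_H x (Suc n) kernel_vec1 kernel_vec2 = 0"
    by (simp add: inner_H_of_coords sum_4)
  moreover have "cnj (c 2) * cnj (c 1) + - cnj (c 1) * cnj (c 2) + 0 * cnj (c 3) = 0"
    by simp
  moreover have "cnj (c 3) * c 1 * cnj (c 1) + cnj (c 3) * c 2 * cnj (c 2) + - ?N * cnj (c 3) = 0"
    by (simp add: algebra_simps)
  ultimately show ?thesis
    by blast
qed

text \<open>The two kernel vectors form a basis. If instead \<open>cmod (c 0) = 1\<close>, the
  commutator is zero and the kernel is the whole block.\<close>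

lemma dim_kernel:
  assumes c0: "c 0 \<noteq> 0" "cmod (c 0) \<noteq> 1"
  shows "vector_space.dim fscale (eigspace_on (Hsub x n j) K 0) = 2"
proof -
  interpret vs: vector_space "fscale :: complex \<Rightarrow> ('p \<Rightarrow> complex) \<Rightarrow> _"
    by (rule vector_space_fscale)
  let ?N = "cnj (c 1) * c 1 + cnj (c 2) * c 2"
  \<comment> \<open>Otherwise the product relation gives \<open>c 3 = 0\<close>, hence
    \<open>tail_norm = 0\<close> and \<open>cmod (c 0) = 1\<close>.\<close>
  have c12: "c 1 \<noteq> 0 \<or> c 2 \<noteq> 0"
    using coupling_product_relation tail_norm_eq_0_iff c0 by auto
  then have N: "?N \<noteq> 0"
    using sum_cnj_mult_eq_0_iff by blast
  have nz: "kernel_vec1 \<noteq> 0" "kernel_vec2 \<noteq> 0"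
    using c12 N by (auto simp only: of_coords_eq_0_iff neg_equal_0_iff_equal complex_cnj_zero_iff)
  \<comment> \<open>The last coordinate is 0 for the first vector and \<open>- ?N\<close> for the
    second, which forces \<open>k = 0\<close>.\<close>
  have not_multiple: "kernel_vec1 \<noteq> fscale k kernel_vec2" for k
  proof
    assume eq: "kernel_vec1 = fscale k kernel_vec2"
    then have "kernel_vec1 (y 3) = k * kernel_vec2 (y 3)"
      by (simp add: fscale_def)
    then have "0 = k * - ?N"
      by (simp add: of_coords_y)
    then have "k = 0"
      using N by (metis mult_eq_0_iff neg_equal_0_iff_equal)
    then show False
      using eq nz by (simp add: fscale_def zero_fun_def)
  qed
  show ?thesis
  proof (rule vs.dim_unique)
    show "{kernel_vec1, kernel_vec2} \<subseteq> eigspace_on (Hsub x n j) K 0"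
      by (simp only: insert_subset empty_subsetI eigspace_on_def mem_Collect_eq of_coords_in_Hsub simp_thms)
        (intro conjI K_kernel_vec; simp add: algebra_simps)
    show "eigspace_on (Hsub x n j) K 0 \<subseteq> vs.span {kernel_vec1, kernel_vec2}"
    proof
      fix v assume "v \<in> eigspace_on (Hsub x n j) K 0"
      then have v: "v \<in> Hsub x n j" and K: "K v = fscale 0 v"
        by (auto simp: eigspace_on_def)
      have v0: "v (y 0) = 0"
        using K c0 c12 unfolding K_eq_fscale_iff[OF v] by auto
      have "tail_overlap v = 0"
        using K c0 unfolding K_eq_fscale_iff[OF v] by simp
      \<comment> \<open>\<open>s\<close> is the inner product of \<open>kernel_vec1\<close> with
        \<open>v\<close> over the squared norm \<open>?N\<close> of \<open>kernel_vec1\<close>;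
        \<open>t\<close> is read off from the last coordinate.\<close>
      define s where "s = (c 2 * v (y 1) - c 1 * v (y 2)) / ?N"
      define t where "t = - v (y 3) / ?N"
      have "v = fscale s kernel_vec1 + fscale t kernel_vec2"
      proof (rule Hsub_eqI[OF v])
        show "fscale s kernel_vec1 + fscale t kernel_vec2 \<in> Hsub x n j"
          using of_coords_in_Hsub by (simp add: Hsub_iff fscale_def)
      next
        \<comment> \<open>Eliminating \<open>v (y 3)\<close> by orthogonality turns the numerators
          below into \<open>v (y 1) * ?N\<close> and \<open>v (y 2) * ?N\<close>.\<close>
        have ov: "cnj (c 3) * v (y 3) = - cnj (c 1) * v (y 1) - cnj (c 2) * v (y 2)"
          using \<open>tail_overlap v = 0\<close> by (simp add: eq_neg_iff_add_eq_0 algebra_simps)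
        have "(c 2 * v (y 1) - c 1 * v (y 2)) * cnj (c 2) + - v (y 3) * (cnj (c 3) * c 1) = (c 2 * v (y 1) - c 1 * v (y 2)) * cnj (c 2) - (cnj (c 3) * v (y 3)) * c 1"
          by (simp add: algebra_simps)
        also have "\<dots> = v (y 1) * ?N"
          unfolding ov by (simp add: algebra_simps)
        finally have "((c 2 * v (y 1) - c 1 * v (y 2)) * cnj (c 2) + - v (y 3) * (cnj (c 3) * c 1)) / ?N = v (y 1) * ?N / ?N"
          by (simp only:)
        then have "s * cnj (c 2) + t * (cnj (c 3) * c 1) = v (y 1)"
          by (simp only: s_def t_def add_divide_distrib times_divide_eq_left
            nonzero_mult_div_cancel_right[OF N])
        then show "v (y 1) = (fscale s kernel_vec1 + fscale t kernel_vec2) (y 1)"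
          using of_coords_y[of 1] by (simp add: fscale_def)
        have "(c 2 * v (y 1) - c 1 * v (y 2)) * - cnj (c 1) + - v (y 3) * (cnj (c 3) * c 2) = (c 2 * v (y 1) - c 1 * v (y 2)) * - cnj (c 1) - (cnj (c 3) * v (y 3)) * c 2"
          by (simp add: algebra_simps)
        also have "\<dots> = v (y 2) * ?N"
          unfolding ov by (simp add: algebra_simps)
        finally have "((c 2 * v (y 1) - c 1 * v (y 2)) * - cnj (c 1) + - v (y 3) * (cnj (c 3) * c 2)) / ?N = v (y 2) * ?N / ?N"
          by (simp only:)
        then have "s * - cnj (c 1) + t * (cnj (c 3) * c 2) = v (y 2)"
          by (simp only: s_def t_def add_divide_distrib times_divide_eq_left
            nonzero_mult_div_cancel_right[OF N])
        then show "v (y 2) = (fscale s kernel_vec1 + fscale t kernel_vec2) (y 2)"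
          using of_coords_y[of 2] by (simp add: fscale_def)
        show "v (y 0) = (fscale s kernel_vec1 + fscale t kernel_vec2) (y 0)"
          using of_coords_y[of 0] v0 by (simp add: fscale_def)
        have "t * - ?N = v (y 3)"
          by (simp only: t_def times_divide_eq_left minus_mult_minus nonzero_mult_div_cancel_right[OF N])
        then show "v (y 3) = (fscale s kernel_vec1 + fscale t kernel_vec2) (y 3)"
          using of_coords_y[of 3] by (simp add: fscale_def)
      qed
      then show "v \<in> vs.span {kernel_vec1, kernel_vec2}"
        by (simp only:) (intro vs.span_add vs.span_scale vs.span_base insertI1 insertI2)
    qed
    show "vs.independent {kernel_vec1, kernel_vec2}"
    proof (rule vs.independent_insertI)
      show "kernel_vec1 \<notin> vs.span {kernel_vec2}"
        unfolding vs.span_singleton using not_multiple by blast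
      show "vs.independent {kernel_vec2}"
        using nz(2) by (simp only: vs.dependent_single not_False_eq_True)
    qed
    show "card {kernel_vec1, kernel_vec2} = 2"
    proof -
      have "kernel_vec1 \<noteq> kernel_vec2"
        using not_multiple[of 1] unfolding fscale_def mult_1 .
      then show ?thesis
        by (rule card_2_iff[THEN iffD2, OF exI, OF exI, OF conjI, OF refl])
    qed
  qed
qed

end

section \<open>The spectrum of the commutator\<close>

theorem theorem5p1:
  fixes x :: "nat \<Rightarrow> nat \<Rightarrow> 'p"
    and a :: "'p \<Rightarrow> 'p \<Rightarrow> complex"
    and n j :: nat
  assumes "poset_labelling x"
    and "unitary_transition_amplitude x a"
    and "product_coupling x a"
    and "n \<ge> 1" and "j < 4 ^ (n - 1)"
    and "coupling x a n j 0 \<noteq> 0"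
  defines "c \<equiv> coupling x a n j"
    and "H \<equiv> Hsub x n j"
    and "K \<equiv> commutator (Qop x n 0) (Pop x a n j 0)"
    and "lp \<equiv> \<i> * complex_of_real (cmod (coupling x a n j 0) * sqrt (1 - (cmod (coupling x a n j 0))\<^sup>2))"
    and "lm \<equiv> - \<i> * complex_of_real (cmod (coupling x a n j 0) * sqrt (1 - (cmod (coupling x a n j 0))\<^sup>2))"
  shows
    \<comment> \<open>the eigenvalues, and their multiplicities as roots of the characteristic polynomial\<close>
    "eigvals_on H K = {0, lp, lm} \<and>
     char_poly (block_mat x n j K) = (\<Prod>l\<leftarrow>[0, 0, lp, lm]. [:- l, 1:]) \<and>
     (cmod (c 0) \<noteq> 1 \<longrightarrow>
        lp \<noteq> 0 \<and> lm \<noteq> 0 \<and> lp \<noteq> lm \<and>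
        vector_space.dim fscale (eigspace_on H K 0) = 2) \<and>
     \<comment> \<open>the eigenvectors for the eigenvalue 0\<close>
     (\<exists>a1 b1 c1 a2 b2 c2.
        a1 * cnj (c 1) + b1 * cnj (c 2) + c1 * cnj (c 3) = 0 \<and>
        a2 * cnj (c 1) + b2 * cnj (c 2) + c2 * cnj (c 3) = 0 \<and>
        inner_H x (n + 1) (of_coords x n j [0, a1, b1, c1]) (of_coords x n j [0, a2, b2, c2]) = 0 \<and>
        of_coords x n j [0, a1, b1, c1] \<noteq> 0 \<and> of_coords x n j [0, a2, b2, c2] \<noteq> 0) \<and>
     (\<forall>a1 b1 c1 a2 b2 c2.
        a1 * cnj (c 1) + b1 * cnj (c 2) + c1 * cnj (c 3) = 0 \<and>
        a2 * cnj (c 1) + b2 * cnj (c 2) + c2 * cnj (c 3) = 0 \<and>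
        inner_H x (n + 1) (of_coords x n j [0, a1, b1, c1]) (of_coords x n j [0, a2, b2, c2]) = 0 \<and>
        of_coords x n j [0, a1, b1, c1] \<noteq> 0 \<and> of_coords x n j [0, a2, b2, c2] \<noteq> 0 \<longrightarrow>
        eigvec_on H K 0 (of_coords x n j [0, a1, b1, c1]) \<and>
        eigvec_on H K 0 (of_coords x n j [0, a2, b2, c2])) \<and>
     \<comment> \<open>the eigenvectors for lp and lm; both formulas give the zero vector if \<open>cmod (c 0) = 1\<close>\<close>
     (\<forall>l\<in>{lp, lm}.
        let v = of_coords x n j [l, - cnj (c 0) * c 1, - cnj (c 0) * c 2, - cnj (c 0) * c 3]
        in v \<in> H \<and> K v = fscale l v \<and> (cmod (c 0) \<noteq> 1 \<longrightarrow> eigvec_on H K l v))"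
proof -
  interpret coupled_block x n j a
    using assms(1,3-5) by unfold_locales
  let ?R = "cmod (c 0) * sqrt (1 - (cmod (c 0))\<^sup>2)"
  have lm: "lm = - lp"
    by (simp add: lm_def lp_def)
  have "?R\<^sup>2 = (cmod (c 0))\<^sup>2 * (1 - (cmod (c 0))\<^sup>2)"
    \<comment> \<open>The bound matters because \<open>sqrt\<close> of a negative number is the
      negated root of its absolute value, whose square would have the wrong sign.\<close>
    using cmod_c0_le_1 by (simp add: c_def power_mult_distrib)
  moreover have "lp\<^sup>2 = - complex_of_real (?R\<^sup>2)"
    by (simp add: lp_def c_def power_mult_distrib)
  ultimately have "lp\<^sup>2 = - complex_of_real ((cmod (c 0))\<^sup>2 * (1 - (cmod (c 0))\<^sup>2))"
    by simp
  also have "\<dots> = - (cnj (c 0) * c 0) * (1 - cnj (c 0) * c 0)"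
    by (simp add: cnj_mult_eq_of_real)
  also have "1 - cnj (c 0) * c 0 = tail_norm"
    unfolding c_def by (rule tail_norm_eq[symmetric])
  finally have lp_sq: "lp\<^sup>2 = - (cnj (c 0) * c 0) * tail_norm" .
  have l_sq: "l\<^sup>2 = - (cnj (c 0) * c 0) * tail_norm" if "l \<in> {lp, lm}" for l
    using that lp_sq lm by auto
  \<comment> \<open>As \<open>c 0\<close> is nonzero, only the factor \<open>tail_norm\<close> of
    the square can vanish.\<close>
  have lp_eq_0: "lp = 0 \<longleftrightarrow> cmod (c 0) = 1"
  proof -
    have "lp = 0 \<longleftrightarrow> lp\<^sup>2 = 0"
      by simp
    also have "\<dots> \<longleftrightarrow> cmod (c 0) = 1"
      unfolding lp_sq using assms(6) tail_norm_eq_0_iff by (simp add: c_def)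
    finally show ?thesis .
  qed
  let ?v = "\<lambda>l. of_coords x n j [l, - cnj (c 0) * c 1, - cnj (c 0) * c 2, - cnj (c 0) * c 3]"
  have v_H: "of_coords x n j zs \<in> H" for zs
    unfolding H_def by (rule of_coords_in_Hsub)
  have K_v: "K (?v l) = fscale l (?v l)" if "l \<in> {lp, lm}" for l
    using K_nonzero_eigvec l_sq[OF that] unfolding K_def c_def by simp
  have eig_v: "eigvec_on H K l (?v l)" if "l \<in> {lp, lm}" "cmod (c 0) \<noteq> 1" for l
    using that lp_eq_0 lm K_v[OF that(1)] v_H by (auto simp: eigvec_on_def of_coords_eq_0_iff)
  have ker: "eigvec_on H K 0 (of_coords x n j [0, a', b', c'])"
    if "a' * cnj (c 1) + b' * cnj (c 2) + c' * cnj (c 3) = 0" "of_coords x n j [0, a', b', c'] \<noteq> 0"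
    for a' b' c'
    using that K_kernel_vec[of a' b' c'] v_H by (simp add: eigvec_on_def K_def c_def)
  have ex: "\<exists>a1 b1 c1 a2 b2 c2.
        a1 * cnj (c 1) + b1 * cnj (c 2) + c1 * cnj (c 3) = 0 \<and>
        a2 * cnj (c 1) + b2 * cnj (c 2) + c2 * cnj (c 3) = 0 \<and>
        inner_H x (n + 1) (of_coords x n j [0, a1, b1, c1]) (of_coords x n j [0, a2, b2, c2]) = 0 \<and>
        of_coords x n j [0, a1, b1, c1] \<noteq> 0 \<and> of_coords x n j [0, a2, b2, c2] \<noteq> 0"
    using ex_orthogonal_kernel_vecs[OF assms(6)] unfolding c_def Suc_eq_plus1 .
  then have eig_0: "0 \<in> eigvals_on H K"
    using ker unfolding eigvals_on_def by blast
  have eigvals: "eigvals_on H K = {0, lp, lm}"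
  proof
    show "eigvals_on H K \<subseteq> {0, lp, lm}"
    proof
      fix l assume "l \<in> eigvals_on H K"
      then obtain v where "eigvec_on H K l v"
        by (auto simp: eigvals_on_def)
      then have "l = 0 \<or> l\<^sup>2 = lp\<^sup>2"
        using eigval_square[of l v] lp_sq unfolding H_def K_def c_def by auto
      then show "l \<in> {0, lp, lm}"
        by (auto simp: power2_eq_iff lm)
    qed
    show "{0, lp, lm} \<subseteq> eigvals_on H K"
    \<comment> \<open>If \<open>cmod (c 0) = 1\<close>, all three numbers are 0; otherwise the
      explicit vectors have nonzero first coordinate \<open>l\<close>.\<close>
    proof (cases "cmod (c 0) = 1")
      case True
      then show ?thesis
        using eig_0 lp_eq_0 lm by simp
    next
      case False
      then show ?thesis
        using eig_0 eig_v by (auto simp: eigvals_on_def)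
    qed
  qed
  \<comment> \<open>The polynomial is X^2 (X^2 - lp^2), which splits because
    \<open>lm = - lp\<close>.\<close>
  have "char_poly (block_mat x n j K) = [:0, 1:] ^ 4 - [:0, 1:]\<^sup>2 * [:lp\<^sup>2:]"
    using char_poly_K unfolding K_def lp_sq c_def by simp
  also have "\<dots> = (\<Prod>l\<leftarrow>[0, 0, lp, lm]. [:- l, 1:])"
    by (simp add: lm eval_nat_numeral)
  finally have cp: "char_poly (block_mat x n j K) = (\<Prod>l\<leftarrow>[0, 0, lp, lm]. [:- l, 1:])" .
  have dim: "lp \<noteq> 0 \<and> lm \<noteq> 0 \<and> lp \<noteq> lm \<and> vector_space.dim fscale (eigspace_on H K 0) = 2"
    if "cmod (c 0) \<noteq> 1"
    using that lp_eq_0 dim_kernel[OF assms(6)] by (simp add: lm H_def K_def c_def)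
  show ?thesis
    using eigvals cp dim ex ker v_H K_v eig_v unfolding Let_def by blast
qed

end
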